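(* Let $r>0$, let $\mathcal D$ be a distribution over $\mathcal X\times\{\pm1\}$, and let $W$ be a weight function. Let $X$ be a random variable with distribution $\mathcal D_{\mathcal X}$ and let $S=\{(x_1,y_1),\dots,(x_n,y_n)\}\sim\mathcal D^n$. Suppose that for any $0<a<b$, $$\lim_{n\to\infty}\mathbb E_{X,S}\Big[\sup_{x'\in B(X,a)}\sum_{i=1}^n w_i^S(x')\,I_{d(x_i,x')>b}\Big]=0.$$ Then, if $\mathcal D$ is $r$-separated, $W$ is $r$-consistent with respect to $\mathcal D$.
   Context: $\mathcal X$ is a totally bounded metric space with metric $d$; $B(x,r)$ is the closed ball of radius $r$ centered at $x$; labels are in $\{\pm1\}=\{-1,+1\}$. $\mathcal D_{\mathcal X}$ is the marginal of $\mathcal D$ on $\mathcal X$, and $I_E$ is the indicator of $E$. A weight function $W$ is a classification algorithm which, given a finite sample $S=\{(x_1,y_1),\dots,(x_n,y_n)\}$, constructs functions $w_1^S,\dots,w_n^S:\mathcal X\to[0,1]$ with $\sum_{i=1}^n w_i^S(x)=1$ for all $x\in\mathcal X$; the functions $w_i^S$ may depend on $x_1,\dots,x_n$ but not on $y_1,\dots,y_n$. It outputs the classifier $W_S$ with $W_S(x)=+1$ if $\sum_{i=1}^n w_i^S(x)y_i>0$ and $W_S(x)=-1$ if $\sum_{i=1}^n w_i^S(x)y_i\le 0$. The astuteness of a classifier $f:\mathcal X\to\{\pm1\}$ at radius $\rho\ge 0$ is $A_\rho(f,\mathcal D)=P_{(x,y)\sim\mathcal D}[f(x')=y\ \ \forall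 x'\in B(x,\rho)]$, and $A_r^*(\mathcal D)$ is the maximum of $A_r(f,\mathcal D)$ over all $f:\mathcal X\to\{\pm1\}$. A classification algorithm $M$ (mapping a sample $S$ to a classifier $M(S)$) is $r$-consistent with respect to $\mathcal D$ if for any $\epsilon,\delta\in(0,1)$ and $0<\gamma<r$ there exists $N$ such that for all $n\ge N$, with probability at least $1-\delta$ over $S\sim\mathcal D^n$, $A_{r-\gamma}(M(S),\mathcal D)\ge A_r^*(\mathcal D)-\epsilon$. $\mathcal D$ is $r$-separated if there exist subsets $T^+,T^-\subset\mathcal X$ such that $P_{(x,y)\sim\mathcal D}[x\in T^y]=1$ (where $T^{+1}=T^+$, $T^{-1}=T^-$) and $d(x_1,x_2)>2r$ for all $x_1\in T^+$, $x_2\in T^-$. *)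

theory Defs
  imports "HOL-Probability.Probability"
begin

text \<open>
  The marginal space is a type of class metric_space, assumed totally bounded where needed.
  Labels are the reals \<open>-1\<close> and \<open>1\<close>. A distribution over labelled points is a probability
  measure on the product of the Borel sets and the discrete space \<open>{-1, 1}\<close>.
\<close>

definition labelled_borel :: "('a::metric_space \<times> real) measure" where
  "labelled_borel = borel \<Otimes>\<^sub>M count_space {-1, 1}"

text \<open>
  No measurability is required of classifiers or of weights, so the events and suprema below may
  fail to be measurable. Probabilities that are bounded below are read as inner probabilities, and
  expectations of nonnegative functions as upper integrals; both agree with the library notions
  on measurable arguments. (The library's \<open>measure\<close> is \<open>0\<close> on non-measurable sets, and
  \<open>nn_integral\<close> is a lower integral on non-measurable functions.)
\<close>

definition inner_prob :: "'a measure \<Rightarrow> 'a set \<Rightarrow> real" where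
  "inner_prob M A = (SUP B\<in>{B \<in> sets M. B \<subseteq> A}. measure M B)"

definition upper_nn_integral :: "'a measure \<Rightarrow> ('a \<Rightarrow> ennreal) \<Rightarrow> ennreal" where
  "upper_nn_integral M f =
     (INF g\<in>{g \<in> borel_measurable M. \<forall>x\<in>space M. f x \<le> g x}. \<integral>\<^sup>+x. g x \<partial>M)"

lemma inner_prob_eq_measure:
  assumes "prob_space M" "A \<in> sets M"
  shows "inner_prob M A = measure M A"
proof -
  interpret prob_space M by fact
  show ?thesis unfolding inner_prob_def
    by (rule cSup_eq_maximum) (use assms(2) in \<open>auto intro!: finite_measure_mono\<close>)
qed

lemma upper_nn_integral_eq_nn_integral:
  assumes "f \<in> borel_measurable M"
  shows "upper_nn_integral M f = (\<integral>\<^sup>+x. f x \<partial>M)"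
  unfolding upper_nn_integral_def
  by (rule antisym)
     (use assms in \<open>auto intro!: INF_lower2[of f] INF_greatest nn_integral_mono\<close>)

definition classifiers :: "('a \<Rightarrow> real) set" where
  "classifiers = UNIV \<rightarrow> {-1, 1}"

definition astuteness ::
  "('a::metric_space \<times> real) measure \<Rightarrow> real \<Rightarrow> ('a \<Rightarrow> real) \<Rightarrow> real" where
  "astuteness D \<rho> f = inner_prob D {(x, y) \<in> space D. \<forall>x'\<in>cball x \<rho>. f x' = y}"

definition optimal_astuteness :: "('a::metric_space \<times> real) measure \<Rightarrow> real \<Rightarrow> real" where
  "optimal_astuteness D r = (SUP f\<in>classifiers. astuteness D r f)"

text \<open>
  A sample of size \<open>n\<close> is a function on indices \<open>0, \<dots>, n - 1\<close> (undefined elsewhere), and \<open>\<D>\<^sup>n\<close> is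
  the product measure on such functions. An algorithm maps a size and a sample to a classifier.
\<close>

type_synonym 'a sample = "nat \<Rightarrow> 'a \<times> real"

definition samples :: "nat \<Rightarrow> 'a sample set" where
  "samples n = ({..<n} \<rightarrow>\<^sub>E UNIV \<times> {-1, 1})"

definition sample_measure :: "nat \<Rightarrow> ('a \<times> real) measure \<Rightarrow> 'a sample measure" where
  "sample_measure n D = (\<Pi>\<^sub>M i\<in>{..<n}. D)"

definition r_consistent ::
  "('a::metric_space \<times> real) measure \<Rightarrow> real \<Rightarrow> (nat \<Rightarrow> 'a sample \<Rightarrow> 'a \<Rightarrow> real) \<Rightarrow> bool" where
  "r_consistent D r M \<longleftrightarrow>
     (\<forall>\<epsilon> \<delta> \<gamma>. 0 < \<epsilon> \<and> \<epsilon> < 1 \<and> 0 < \<delta> \<and> \<delta> < 1 \<and> 0 < \<gamma> \<and> \<gamma> < r \<longrightarrow>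
       (\<exists>N. \<forall>n\<ge>N.
          inner_prob (sample_measure n D)
            {S \<in> space (sample_measure n D).
               astuteness D (r - \<gamma>) (M n S) \<ge> optimal_astuteness D r - \<epsilon>} \<ge> 1 - \<delta>))"

text \<open>
  \<open>w n S i x\<close> is the weight at \<open>x\<close> of the \<open>i\<close>-th point of the sample \<open>S\<close> of size \<open>n\<close>. Samples are
  nonempty here, since empty weights cannot sum to one.
\<close>

definition weight_function :: "(nat \<Rightarrow> 'a sample \<Rightarrow> nat \<Rightarrow> 'a \<Rightarrow> real) \<Rightarrow> bool" where
  "weight_function w \<longleftrightarrow>
     (\<forall>n>0.
        (\<forall>S\<in>samples n. \<forall>x. (\<forall>i<n. w n S i x \<in> {0..1}) \<and> (\<Sum>i<n. w n S i x) = 1) \<and>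
        (\<forall>S\<in>samples n. \<forall>S'\<in>samples n.
           (\<forall>i<n. fst (S i) = fst (S' i)) \<longrightarrow> (\<forall>i<n. w n S i = w n S' i)))"

definition weight_classifier ::
  "(nat \<Rightarrow> 'a sample \<Rightarrow> nat \<Rightarrow> 'a \<Rightarrow> real) \<Rightarrow> nat \<Rightarrow> 'a sample \<Rightarrow> 'a \<Rightarrow> real" where
  "weight_classifier w n S x = (if (\<Sum>i<n. w n S i x * snd (S i)) > 0 then 1 else -1)"

text \<open>The sets \<open>Tp\<close> and \<open>Tm\<close> need not be measurable, so probability one is expressed by \<open>AE\<close>.\<close>

definition r_separated :: "('a::metric_space \<times> real) measure \<Rightarrow> real \<Rightarrow> bool" where
  "r_separated D r \<longleftrightarrow>
     (\<exists>Tp Tm. (AE (x, y) in D. x \<in> (if y = 1 then Tp else Tm)) \<and>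
              (\<forall>x1\<in>Tp. \<forall>x2\<in>Tm. dist x1 x2 > 2 * r))"

definition expected_far_weight ::
  "('a::metric_space \<times> real) measure \<Rightarrow> (nat \<Rightarrow> 'a sample \<Rightarrow> nat \<Rightarrow> 'a \<Rightarrow> real) \<Rightarrow>
   real \<Rightarrow> real \<Rightarrow> nat \<Rightarrow> ennreal" where
  "expected_far_weight D w a b n =
     upper_nn_integral (distr D borel fst \<Otimes>\<^sub>M sample_measure n D)
       (\<lambda>(x, S). ennreal
          (SUP x'\<in>cball x a. \<Sum>i<n. w n S i x' * of_bool (dist (fst (S i)) x' > b)))"

end

theory Submission
  imports Defs
begin

text \<open>
  Call the far weight at \<open>x'\<close> the total weight of the sample points at distance more than \<open>r\<close>
  from \<open>x'\<close>. If \<open>x'\<close> lies within \<open>r - \<gamma>\<close> of a test point \<open>x\<close>, then by separation all sample points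
  within \<open>r\<close> of \<open>x'\<close> carry the label of \<open>x\<close>, so \<open>x'\<close> is classified correctly as soon as its far
  weight is below \<open>1/2\<close>. Applying Markov's inequality twice, first over the sample and then over
  the test point, turns the vanishing expectation (with \<open>a = r - \<gamma>\<close> and \<open>b = r\<close>) into the
  required bound.
\<close>

text \<open>A measurable subset certifies a lower bound; applied below to the good test points and
  to the good samples.\<close>

lemma inner_prob_upper:
  assumes "prob_space M" "B \<in> sets M" "B \<subseteq> A"
  shows "measure M B \<le> inner_prob M A"
proof -
  interpret prob_space M by fact
  show ?thesis
    unfolding inner_prob_def using assms by (intro cSUP_upper) (auto intro!: bdd_aboveI[of _ 1])
qed

lemma inner_prob_le_1:
  assumes "prob_space M"
  shows "inner_prob M A \<le> 1"
proof -
  interpret prob_space M by fact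
  show ?thesis
    unfolding inner_prob_def by (rule cSUP_least) auto
qed

text \<open>Reduces the goal to astuteness at least \<open>1 - \<epsilon>\<close>, with no
  description of the best classifier.\<close>

lemma optimal_astuteness_le_1:
  assumes "prob_space D"
  shows "optimal_astuteness D r \<le> 1"
  unfolding optimal_astuteness_def
proof (rule cSUP_least)
  have "(\<lambda>_. 1) \<in> classifiers" by (auto simp: classifiers_def)
  then show "classifiers \<noteq> {}" by blast
qed (use inner_prob_le_1[OF assms] in \<open>simp add: astuteness_def\<close>)

text \<open>The measurable majorant \<open>g\<close> replaces the possibly non-measurable supremum
  of far weights, so that Tonelli and Markov apply.\<close>

lemma upper_nn_integral_lessE:
  assumes "upper_nn_integral M f < e"
  obtains g where "g \<in> borel_measurable M" "\<And>x. x \<in> space M \<Longrightarrow> f x \<le> g x" "(\<integral>\<^sup>+x. g x \<partial>M) < e"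
  using assms unfolding upper_nn_integral_def INF_less_iff by blast

text \<open>Markov's inequality for the complement: in the bound \<open>c * e\<close>,
  \<open>c\<close> is the threshold and \<open>e\<close> the failure probability.\<close>

lemma (in prob_space) prob_less_ge_Markov:
  fixes u :: "'a \<Rightarrow> ennreal"
  assumes [measurable]: "u \<in> borel_measurable M"
    and "c > 0" "e \<ge> 0" "(\<integral>\<^sup>+x. u x \<partial>M) \<le> ennreal (c * e)"
  shows "prob {x \<in> space M. u x < ennreal c} \<ge> 1 - e"
proof -
  let ?B = "{x \<in> space M. \<not> u x < ennreal c}"
  have "ennreal c * emeasure M ?B = (\<integral>\<^sup>+x. ennreal c * indicator ?B x \<partial>M)"
    by (subst nn_integral_cmult_indicator) auto
  also have "\<dots> \<le> (\<integral>\<^sup>+x. u x \<partial>M)"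
    by (intro nn_integral_mono) (auto simp: indicator_def not_less)
  finally have "ennreal (c * prob ?B) \<le> ennreal (c * e)"
    using assms by (simp add: emeasure_eq_measure ennreal_mult)
  then have "prob ?B \<le> e"
    using assms by (simp add: ennreal_le_iff)
  then show ?thesis
    by (subst (asm) prob_neg) auto
qed

lemma weight_functionD:
  assumes "weight_function w" "n > 0" "S \<in> samples n"
  shows "i < n \<Longrightarrow> w n S i x \<ge> 0" "(\<Sum>i<n. w n S i x) = 1"
proof -
  have "(\<forall>i<n. w n S i x \<in> {0..1}) \<and> (\<Sum>i<n. w n S i x) = 1"
    using assms unfolding weight_function_def by blast
  then show "i < n \<Longrightarrow> w n S i x \<ge> 0" "(\<Sum>i<n. w n S i x) = 1"
    by auto
qed

text \<open>In \<open>y\<close> times the vote, a near point counts with its full weight and a far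
  point at worst with minus its weight. The weights sum to one, so the result is at least one minus
  twice the far weight, which is strictly positive; a tie cannot occur.\<close>

lemma weight_classifier_eq_label:
  assumes "weight_function w" "n > 0" "S \<in> samples n" "y \<in> {-1, 1}"
    and near: "\<And>i. i < n \<Longrightarrow> dist (fst (S i)) x \<le> b \<Longrightarrow> snd (S i) = y"
    and far: "(\<Sum>i<n. w n S i x * of_bool (dist (fst (S i)) x > b)) < 1/2"
  shows "weight_classifier w n S x = y"
proof -
  have w: "\<And>i. i < n \<Longrightarrow> w n S i x \<ge> 0" "(\<Sum>i<n. w n S i x) = 1"
    using weight_functionD[OF assms(1-3)] by blast+
  have "0 < 1 - 2 * (\<Sum>i<n. w n S i x * of_bool (dist (fst (S i)) x > b))"
    using far by simp
  also have "\<dots> = (\<Sum>i<n. w n S i x * (1 - 2 * of_bool (dist (fst (S i)) x > b)))"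
    by (simp add: w(2) right_diff_distrib sum_subtractf sum_distrib_left mult.left_commute
        del: sum_mult_of_bool_eq)
  also have "\<dots> \<le> (\<Sum>i<n. w n S i x * (y * snd (S i)))"
  proof (rule sum_mono)
    fix i assume "i \<in> {..<n}"
    then have i: "i < n" by simp
    have "snd (S i) \<in> {-1, 1}"
      using assms(3) i by (auto simp: samples_def PiE_iff mem_Times_iff)
    then have "1 - 2 * of_bool (dist (fst (S i)) x > b) \<le> y * snd (S i)"
      using near[OF i] assms(4) by (cases "dist (fst (S i)) x > b") auto
    then show "w n S i x * (1 - 2 * of_bool (dist (fst (S i)) x > b)) \<le> w n S i x * (y * snd (S i))"
      using w(1)[OF i] by (rule mult_left_mono)
  qed
  also have "\<dots> = y * (\<Sum>i<n. w n S i x * snd (S i))"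
    by (simp add: sum_distrib_left mult_ac)
  finally show ?thesis
    using assms(4) by (auto simp: weight_classifier_def)
qed

text \<open>The far weight never exceeds the total weight 1, so this supremum of reals is over a
  bounded family and really is an upper bound.\<close>

lemma far_weight_le_SUP:
  assumes "weight_function w" "n > 0" "S \<in> samples n" "x' \<in> A"
  shows "(\<Sum>i<n. w n S i x' * of_bool (dist (fst (S i)) x' > b))
    \<le> (SUP x'\<in>A. \<Sum>i<n. w n S i x' * of_bool (dist (fst (S i)) x' > b))"
proof (rule cSUP_upper[OF assms(4)], rule bdd_aboveI2)
  fix x
  have w: "\<And>i. i < n \<Longrightarrow> w n S i x \<ge> 0" "(\<Sum>i<n. w n S i x) = 1"
    using weight_functionD[OF assms(1-3)] by blast+
  show "(\<Sum>i<n. w n S i x * of_bool (dist (fst (S i)) x > b)) \<le> 1"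
    unfolding w(2)[symmetric] by (rule sum_mono) (use w(1) in auto)
qed

theorem theorem12:
  fixes D :: "('a::metric_space \<times> real) measure"
    and w :: "nat \<Rightarrow> (nat \<Rightarrow> 'a \<times> real) \<Rightarrow> nat \<Rightarrow> 'a \<Rightarrow> real"
    and r :: real
  assumes "totally_bounded (UNIV :: 'a set)"
    and "r > 0"
    and "prob_space D"
    and "sets D = sets labelled_borel"
    and "weight_function w"
    and "\<And>a b. 0 < a \<Longrightarrow> a < b \<Longrightarrow> expected_far_weight D w a b \<longlonglongrightarrow> 0"
    and "r_separated D r"
  shows "r_consistent D r (weight_classifier w)"
  unfolding r_consistent_def
proof (intro allI impI, elim conjE)
  fix \<epsilon> \<delta> \<gamma> :: real
  assume \<epsilon>: "0 < \<epsilon>" and \<delta>: "0 < \<delta>" and \<gamma>: "0 < \<gamma>" "\<gamma> < r"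
  interpret D: prob_space D by fact
  have space_D: "space D = UNIV \<times> {-1, 1}"
    using sets_eq_imp_space_eq[OF assms(4)] by (simp add: labelled_borel_def space_pair_measure)
  have fst_D [measurable]: "fst \<in> borel_measurable D"
    unfolding measurable_cong_sets[OF assms(4) refl] labelled_borel_def by measurable
  let ?X = "distr D borel fst"
  interpret X: prob_space ?X by (rule D.prob_space_distr) measurable

  obtain Tp Tm where T: "AE (x, y) in D. x \<in> (if y = 1 then Tp else Tm)"
      "\<And>x1 x2. x1 \<in> Tp \<Longrightarrow> x2 \<in> Tm \<Longrightarrow> dist x1 x2 > 2 * r"
    using assms(7) unfolding r_separated_def by blast
  \<comment> \<open>\<open>Tp\<close> and \<open>Tm\<close> may be non-measurable; \<open>E\<close>
    is a measurable set of full measure on which the separation holds at every point.\<close>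
  obtain E where E: "E \<in> sets D" "AE z in D. z \<in> E"
      "\<And>x y. (x, y) \<in> E \<Longrightarrow> (x, y) \<in> space D \<and> x \<in> (if y = 1 then Tp else Tm)"
  proof -
    from T(1) obtain F where "F \<in> null_sets D"
        "\<And>z. z \<in> space D - F \<Longrightarrow> case z of (x, y) \<Rightarrow> x \<in> (if y = 1 then Tp else Tm)"
      by (rule AE_E3) blast
    then show thesis
      using AE_not_in[of F D] by (intro that[of "space D - F"]) fastforce+
  qed
  have same_label: "y = y'" if "(x, y) \<in> E" "(x', y') \<in> E" "dist x x' \<le> 2 * r" for x y x' y'
  proof (rule ccontr)
    assume "y \<noteq> y'"
    with E(3)[OF that(1)] E(3)[OF that(2)]
    have "x \<in> Tp \<and> x' \<in> Tm \<or> x \<in> Tm \<and> x' \<in> Tp"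
      by (auto simp: space_D split: if_splits)
    then show False
      using T(2)[of x x'] T(2)[of x' x] that(3) by (auto simp: dist_commute)
  qed

  \<comment> \<open>The threshold serves both uses of Markov: level \<open>\<epsilon> / 2\<close>
    with failure \<open>\<delta>\<close> over samples, then level \<open>1/2\<close> with failure
    \<open>\<epsilon>\<close> over test points.\<close>
  have "\<forall>\<^sub>F n in sequentially. expected_far_weight D w (r - \<gamma>) r n < ennreal (\<epsilon> / 2 * \<delta>)"
    using assms(6)[of "r - \<gamma>" r] \<gamma> \<epsilon> \<delta> by (intro order_tendstoD(2)) auto
  then obtain N where
    N: "\<And>n. n \<ge> N \<Longrightarrow> expected_far_weight D w (r - \<gamma>) r n < ennreal (\<epsilon> / 2 * \<delta>)"
    by (auto simp: eventually_sequentially)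
  show "\<exists>N. \<forall>n\<ge>N. inner_prob (sample_measure n D)
      {S \<in> space (sample_measure n D).
        optimal_astuteness D r - \<epsilon> \<le> astuteness D (r - \<gamma>) (weight_classifier w n S)} \<ge> 1 - \<delta>"
  \<comment> \<open>The maximum with 1 excludes the empty sample, on which weights are
    unconstrained.\<close>
  proof (intro exI[of _ "max N 1"] allI impI)
    fix n assume "n \<ge> max N 1"
    then have n: "n \<ge> N" "n > 0" by auto
    let ?M = "sample_measure n D"
    interpret M: prob_space ?M
      unfolding sample_measure_def by (rule prob_space_PiM) (rule assms(3))
    interpret XM: pair_sigma_finite ?X ?M ..
    have space_M: "space ?M = samples n"
      by (simp add: sample_measure_def samples_def space_PiM space_D)
    from N[OF n(1)] obtain g where g [measurable]: "g \<in> borel_measurable (?X \<Otimes>\<^sub>M ?M)"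
      and g_ge: "\<And>x S. S \<in> samples n \<Longrightarrow> ennreal (SUP x'\<in>cball x (r - \<gamma>). \<Sum>i<n.
        w n S i x' * of_bool (dist (fst (S i)) x' > r)) \<le> g (x, S)"
      and g_int: "(\<integral>\<^sup>+z. g z \<partial>(?X \<Otimes>\<^sub>M ?M)) < ennreal (\<epsilon> / 2 * \<delta>)"
      unfolding expected_far_weight_def
      by (elim upper_nn_integral_lessE) (auto simp: space_pair_measure space_M)

    \<comment> \<open>The mean majorant for a fixed sample; by Tonelli its integral over samples is
      the double integral of \<open>g\<close>.\<close>
    define h where "h S = (\<integral>\<^sup>+x. g (x, S) \<partial>?X)" for S
    have h [measurable]: "h \<in> borel_measurable ?M"
      unfolding h_def by measurable
    have "(\<integral>\<^sup>+S. h S \<partial>?M) \<le> ennreal (\<epsilon> / 2 * \<delta>)"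
      unfolding h_def XM.nn_integral_snd[OF g] using g_int by simp
    then have prob_h: "M.prob {S \<in> space ?M. h S < ennreal (\<epsilon> / 2)} \<ge> 1 - \<delta>"
      using \<epsilon> \<delta> by (intro M.prob_less_ge_Markov) auto

    \<comment> \<open>The good samples. Requiring all sample points to lie in \<open>E\<close> costs
      no probability and makes \<open>same_label\<close> applicable to them.\<close>
    define G where "G = {S \<in> space ?M. h S < ennreal (\<epsilon> / 2) \<and> (\<forall>i<n. S i \<in> E)}"
    have comp [measurable]: "(\<lambda>S. S i) \<in> ?M \<rightarrow>\<^sub>M D" if "i < n" for i
      unfolding sample_measure_def using that by (intro measurable_component_singleton) simp
    have G_sets: "G \<in> sets ?M"
    proof -
      have "{S \<in> space ?M. S i \<in> E} \<in> sets ?M" if "i < n" for i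
        using measurable_sets[OF comp[OF that] E(1)] by (simp add: vimage_def Int_def conj_commute)
      then have "{S \<in> space ?M. \<forall>i\<in>{..<n}. S i \<in> E} \<in> sets ?M"
        by (intro sets.sets_Collect_finite_All) auto
      moreover have "{S \<in> space ?M. h S < ennreal (\<epsilon> / 2)} \<in> sets ?M"
        by measurable
      ultimately have "{S \<in> space ?M. h S < ennreal (\<epsilon> / 2)} \<inter> {S \<in> space ?M. \<forall>i\<in>{..<n}. S i \<in> E} \<in> sets ?M"
        by (intro sets.Int)
      then show ?thesis
        by (rule back_subst[of "\<lambda>A. A \<in> sets ?M"]) (auto simp: G_def)
    qed
    have "AE S in ?M. S i \<in> E" if "i < n" for i
      unfolding sample_measure_def using that E(2) assms(3)
      by (intro AE_PiM_component[where P = "\<lambda>z. z \<in> E"]) auto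
    then have "AE S in ?M. \<forall>i\<in>{..<n}. S i \<in> E"
      by (intro AE_finite_allI) auto
    then have "AE S in ?M. S \<in> G \<longleftrightarrow> S \<in> {S \<in> space ?M. h S < ennreal (\<epsilon> / 2)}"
      by (rule eventually_mono) (auto simp: G_def)
    then have "M.prob G = M.prob {S \<in> space ?M. h S < ennreal (\<epsilon> / 2)}"
      by (rule M.finite_measure_eq_AE) (rule G_sets, measurable)
    with prob_h have prob_G: "M.prob G \<ge> 1 - \<delta>" by simp

    have "optimal_astuteness D r - \<epsilon> \<le> astuteness D (r - \<gamma>) (weight_classifier w n S)" if "S \<in> G" for S
    proof -
      from that have S: "S \<in> samples n" "h S < ennreal (\<epsilon> / 2)" "\<And>i. i < n \<Longrightarrow> S i \<in> E"
        by (auto simp: G_def space_M)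
      have "S \<in> space ?M" using S(1) by (simp add: space_M)
      from measurable_compose[OF measurable_Pair2'[OF this] g]
      have gS: "(\<lambda>x. g (x, S)) \<in> borel_measurable borel"
        by (simp cong: measurable_cong_sets)
      have gS' [measurable]: "(\<lambda>z. g (fst z, S)) \<in> borel_measurable D"
        by (rule measurable_compose[OF fst_D gS])
      \<comment> \<open>The integral over the marginal is pulled back to \<open>D\<close>, since
        astuteness also involves the label of the test point.\<close>
      have "(\<integral>\<^sup>+z. g (fst z, S) \<partial>D) \<le> ennreal (1/2 * \<epsilon>)"
        using S(2) nn_integral_distr[OF fst_D, of "\<lambda>x. g (x, S)"] gS by (simp add: h_def)
      then have prob_z: "D.prob {z \<in> space D. g (fst z, S) < ennreal (1/2)} \<ge> 1 - \<epsilon>"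
        using \<epsilon> by (intro D.prob_less_ge_Markov[OF gS']) auto
      let ?C = "{z \<in> space D. g (fst z, S) < ennreal (1/2)} \<inter> E"
      have C: "?C \<in> sets D"
        using E(1) by (intro sets.Int[OF _ E(1)]) measurable
      have prob_C: "D.prob ?C = D.prob {z \<in> space D. g (fst z, S) < ennreal (1/2)}"
      proof (rule D.finite_measure_eq_AE[OF _ C])
        show "AE z in D. z \<in> ?C \<longleftrightarrow> z \<in> {z \<in> space D. g (fst z, S) < ennreal (1/2)}"
          using E(2) by (rule eventually_mono) auto
      qed measurable
      have correct: "weight_classifier w n S x' = y"
        if xy: "(x, y) \<in> space D" "(x, y) \<in> E" "g (x, S) < ennreal (1/2)"
          and x': "x' \<in> cball x (r - \<gamma>)" for x y x'
      proof (rule weight_classifier_eq_label[OF assms(5) n(2) S(1)])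
        show "y \<in> {-1, 1}" using xy(1) by (simp add: space_D)
        fix i assume i: "i < n" "dist (fst (S i)) x' \<le> r"
        \<comment> \<open>The near sample point is within \<open>r + (r - \<gamma>) < 2 * r\<close>
          of the test point, so separation forces equal labels.\<close>
        have "dist (fst (S i)) x \<le> dist (fst (S i)) x' + dist x x'"
          by (rule dist_triangle2)
        then show "snd (S i) = y"
          using i x' \<gamma> S(3)[OF i(1)] xy(2) by (intro same_label[of "fst (S i)" _ x]) auto
      next
        \<comment> \<open>One bound on the supremum handles every \<open>x'\<close> in the ball at
          once, as astuteness demands.\<close>
        have "ennreal (SUP x'\<in>cball x (r - \<gamma>). \<Sum>i<n.
            w n S i x' * of_bool (dist (fst (S i)) x' > r)) < ennreal (1/2)"
          using g_ge[OF S(1), of x] xy(3) by simp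
        then show "(\<Sum>i<n. w n S i x' * of_bool (dist (fst (S i)) x' > r)) < 1/2"
          using far_weight_le_SUP[OF assms(5) n(2) S(1) x', of r]
          by (meson ennreal_leI le_less_trans not_le)
      qed
      have "optimal_astuteness D r - \<epsilon> \<le> D.prob ?C"
        using optimal_astuteness_le_1[OF assms(3), of r] prob_z prob_C by linarith
      also have "D.prob ?C \<le> astuteness D (r - \<gamma>) (weight_classifier w n S)"
        unfolding astuteness_def by (rule inner_prob_upper[OF assms(3) C]) (auto intro: correct)
      finally show ?thesis .
    qed
    then have "G \<subseteq> {S \<in> space ?M.
        optimal_astuteness D r - \<epsilon> \<le> astuteness D (r - \<gamma>) (weight_classifier w n S)}"
      by (auto simp: G_def)
    from inner_prob_upper[OF M.prob_space_axioms G_sets this] prob_G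
    show "1 - \<delta> \<le> inner_prob ?M {S \<in> space ?M.
        optimal_astuteness D r - \<epsilon> \<le> astuteness D (r - \<gamma>) (weight_classifier w n S)}"
      by linarith
  qed
qed

end
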